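(* Let $m$ be a positive integer and let $$W=(m\mathbb{N}+X_m)\cup Y^{(0)}\cup Y^{(1)},$$ where $X_m\subseteq\{0,1,\dots,m-1\}$, $Y^{(0)}\subseteq\mathbb{Z}^{-}$ and $Y^{(1)}\subseteq\mathbb{Z}$ are finite sets, $(Y^{(0)} \bmod m)\subseteq X_m$, and $(Y^{(1)} \bmod m)\cap X_m=\emptyset$. If there exists a minimal complement to $W$, then there exists $C\subseteq\{0,1,\dots,m-1\}$ such that the following two conditions hold: (a) $\bigl(C+(X_m\cup Y^{(1)})\bigr) \bmod m=\{0,1,\dots,m-1\}$; (b) for any $c\in C$, there exists $y\in Y^{(1)}$ such that $c+y\not\equiv c'+x \pmod m$ for any $c'\in C$ and $x\in X_m$.
   Context: $\mathbb{N}$ is the set of nonnegative integers, $\mathbb{Z}$ the set of integers, $\mathbb{Z}^{-}$ the set of negative integers. For $A,B\subseteq\mathbb{Z}$ and $k\in\mathbb{Z}$, $A+B=\{a+b: a\in A, b\in B\}$ and $kA=\{ka:a\in A\}$. A set $A\subseteq\mathbb{Z}$ is a complement to $B\subseteq\mathbb{Z}$ (in $\mathbb{Z}$) if $A+B=\mathbb{Z}$; it is a minimal complement to $B$ if in addition no proper subset of $A$ is a complement to $B$. For a set $S$ of integers, $S \bmod m=\{r\in\{0,1,\dots,m-1\}: r\equiv s \pmod m \text{ for some } s\in S\}$. *)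

theory Defs
  imports "HOL-Library.Set_Algebras" "HOL-Number_Theory.Cong"
begin

definition is_complement :: "int set \<Rightarrow> int set \<Rightarrow> bool" where
  "is_complement A B \<longleftrightarrow> A + B = UNIV"

definition is_minimal_complement :: "int set \<Rightarrow> int set \<Rightarrow> bool" where
  "is_minimal_complement A B \<longleftrightarrow>
     is_complement A B \<and> (\<forall>A'. A' \<subset> A \<longrightarrow> \<not> is_complement A' B)"

definition set_mod :: "int set \<Rightarrow> int \<Rightarrow> int set"  (infixl \<open>smod\<close> 60) where
  "S smod m = {r \<in> {0..<m}. \<exists>s\<in>S. [r = s] (mod m)}"

end

theory Submission
  imports Defs
begin

text \<open>
  The set \<open>C\<close> consists of the residue classes in which a minimal complement \<open>A\<close> of \<open>W\<close> has
  arbitrarily small elements (\<open>low_residues\<close>). There are two reasons why it works.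

  Covering: \<open>W\<close> is bounded below, so a very negative integer \<open>n = a + w\<close> can only be
  represented with a very negative \<open>a\<close>. The remaining residue classes have a common lower bound
  in \<open>A\<close>, hence such an \<open>a\<close> lies in a class of \<open>C\<close>
  (\<open>low_residues_absorb_small_elements\<close>). As every class contains very negative integers,
  \<open>C + (X \<union> Y1)\<close> meets every class.

  Minimality: an element \<open>a\<close> of \<open>A\<close> in a class \<open>c \<in> C\<close> is needed to represent some \<open>n\<close>. If
  \<open>n \<equiv> c' + x\<close> with \<open>c' \<in> C\<close> and \<open>x \<in> X\<close>, then \<open>n - a'\<close> lies in \<open>m\<nat> + X\<close> for infinitely many
  \<open>a' \<in> A\<close> (\<open>low_residues_represent\<close>), so \<open>a\<close> would be superfluous. Therefore \<open>n\<close> avoids the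
  classes of \<open>C + X\<close>. In particular \<open>n - a\<close> is not in a class of \<open>X\<close>, so it is an element
  \<open>y\<close> of \<open>Y1\<close>, and \<open>c + y \<equiv> n\<close> is the required witness.
\<close>

definition low_residues :: "int set \<Rightarrow> int \<Rightarrow> int set" where
  "low_residues A m = {c \<in> {0..<m}. \<forall>N. \<exists>a\<in>A. a < N \<and> [a = c] (mod m)}"

text \<open>Only finitely many residue classes fail to be low, so the lower bounds of \<open>A\<close> in them
  have a minimum.\<close>

lemma low_residues_absorb_small_elements:
  fixes m :: int
  assumes "m > 0"
  obtains L where "\<And>a. a \<in> A \<Longrightarrow> a < L \<Longrightarrow> a mod m \<in> low_residues A m"
proof -
  define D where "D = {0..<m} - low_residues A m"
  have "\<forall>c\<in>D. \<exists>N. \<forall>a\<in>A. [a = c] (mod m) \<longrightarrow> N \<le> a"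
    by (auto simp: D_def low_residues_def not_less) (meson not_less)
  then obtain N where N: "\<And>c a. c \<in> D \<Longrightarrow> a \<in> A \<Longrightarrow> [a = c] (mod m) \<Longrightarrow> N c \<le> a"
    by metis
  show thesis
  proof
    \<comment> \<open>Inserting \<open>0\<close> gives the minimum a meaning when every class is low.\<close>
    fix a assume a: "a \<in> A" "a < Min (insert 0 (N ` D))"
    show "a mod m \<in> low_residues A m"
    proof (rule ccontr)
      assume "a mod m \<notin> low_residues A m"
      with \<open>m > 0\<close> have D: "a mod m \<in> D" by (simp add: D_def)
      have "finite D" by (simp add: D_def)
      with D have "Min (insert 0 (N ` D)) \<le> N (a mod m)" by simp
      also have "\<dots> \<le> a" using N[OF D a(1)] by (simp add: cong_def)
      finally show False using a(2) by simp
    qed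
  qed
qed

lemma mem_progression_if_cong:
  fixes m :: int
  assumes "m > 0" "x \<in> X" "[k = x] (mod m)" "x \<le> k"
  shows "k \<in> m *o \<nat> + X"
proof -
  obtain q where q: "k = x + m * q"
    using cong_iff_lin[of x k m] assms(3) by (auto simp: cong_sym_eq)
  with assms have "0 \<le> q" by (simp add: zero_le_mult_iff)
  then have "m * q \<in> m *o \<nat>"
    unfolding elt_set_times_def by (auto simp: Nats_altdef1)
  then have "m * q + x \<in> m *o \<nat> + X" using assms(2) by (rule set_plus_intro)
  then show ?thesis by (simp add: q add.commute)
qed

text \<open>The arbitrary bound \<open>N\<close> provides infinitely many representations of \<open>n\<close>, and so one
  that does not use a prescribed element of \<open>A\<close>.\<close>

lemma low_residues_represent:
  fixes m :: int
  assumes "m > 0" "c \<in> low_residues A m" "x \<in> X" "[n = c + x] (mod m)"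
  obtains a where "a \<in> A" "a < N" "n - a \<in> m *o \<nat> + X"
proof -
  obtain a where a: "a \<in> A" "a < min N (n - x)" "[a = c] (mod m)"
    using assms(2) unfolding low_residues_def by blast
  have "[n - a = x] (mod m)" using cong_diff[OF assms(4) a(3)] by simp
  then have "n - a \<in> m *o \<nat> + X"
    using mem_progression_if_cong[OF assms(1,3)] a(2) by simp
  then show thesis using that a by auto
qed

lemma needed_in_minimal_complement:
  assumes "is_minimal_complement A W" "a \<in> A"
  obtains n where "n - a \<in> W" "\<And>a'. a' \<in> A \<Longrightarrow> n - a' \<in> W \<Longrightarrow> a' = a"
proof -
  have AW: "A + W = UNIV" and "(A - {a}) + W \<noteq> UNIV"
    using assms unfolding is_minimal_complement_def is_complement_def by blast+
  then obtain n where n: "n \<notin> (A - {a}) + W" by blast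
  have only: "a' = a" if "a' \<in> A" "n - a' \<in> W" for a'
    using n set_plus_intro[of a' "A - {a}" "n - a'" W] that by auto
  obtain b w where "b \<in> A" "w \<in> W" "n = b + w"
    using AW by (metis UNIV_I set_plus_elim)
  with only[of b] have "n - a \<in> W" by auto
  with only show thesis using that by blast
qed

theorem theorem1:
  fixes m :: int and X Y0 Y1 W :: "int set"
  assumes "m > 0"
    and "X \<subseteq> {0..<m}"
    and "finite Y0" and "Y0 \<subseteq> {..<0}"
    and "finite Y1"
    and "Y0 smod m \<subseteq> X"
    and "(Y1 smod m) \<inter> X = {}"
    and "W = (m *o \<nat> + X) \<union> Y0 \<union> Y1"
    and "\<exists>A. is_minimal_complement A W"
  shows "\<exists>C. C \<subseteq> {0..<m} \<and>
           (C + (X \<union> Y1)) smod m = {0..<m} \<and>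
           (\<forall>c\<in>C. \<exists>y\<in>Y1. \<forall>c'\<in>C. \<forall>x\<in>X. \<not> [c + y = c' + x] (mod m))"
proof -
  obtain A where A: "is_minimal_complement A W" using assms(9) by blast
  define C where "C = low_residues A m"
  have W_cases: "w \<in> Y1 \<or> (\<exists>x\<in>X. [w = x] (mod m))" if "w \<in> W" for w
  proof -
    consider "w \<in> m *o \<nat> + X" | "w \<in> Y0" | "w \<in> Y1" using \<open>w \<in> W\<close> assms(8) by blast
    then show ?thesis
    proof cases
      case 1
      then obtain k x where "x \<in> X" "w = m * k + x"
        by (auto simp: elt_set_times_def elim!: set_plus_elim)
      then show ?thesis by (auto simp: cong_def)
    next
      case 2
      then have "w mod m \<in> Y0 smod m" using \<open>m > 0\<close> by (auto simp: set_mod_def cong_def)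
      then show ?thesis using assms(6) by (auto simp: cong_def intro!: bexI[of _ "w mod m"])
    qed simp
  qed
  have "bdd_below (Y0 \<union> Y1)" using assms(3,5) by simp
  then obtain B where B: "\<And>w. w \<in> Y0 \<union> Y1 \<Longrightarrow> B \<le> w" by (auto simp: bdd_below_def)
  have W_bound: "min 0 B \<le> w" if "w \<in> W" for w
  proof (cases "w \<in> Y0 \<union> Y1")
    case False
    then obtain k x where "k \<in> \<nat>" "x \<in> X" "w = m * k + x"
      using \<open>w \<in> W\<close> assms(8) by (auto simp: elt_set_times_def elim!: set_plus_elim)
    then have "0 \<le> w" using assms(1,2) by (auto simp: Nats_altdef1)
    then show ?thesis by simp
  qed (use B in force)
  show ?thesis
  proof (intro exI[of _ C] conjI)
    show "C \<subseteq> {0..<m}" by (auto simp: C_def low_residues_def)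
  next
    obtain L where L: "\<And>a. a \<in> A \<Longrightarrow> a < L \<Longrightarrow> a mod m \<in> C"
      using low_residues_absorb_small_elements[OF assms(1)] unfolding C_def by metis
    have "r \<in> (C + (X \<union> Y1)) smod m" if r: "r \<in> {0..<m}" for r
    proof -
      \<comment> \<open>Since \<open>m \<ge> 1\<close>, this many steps of length \<open>m\<close> take \<open>r < m\<close> below \<open>L + min 0 B\<close>.\<close>
      define n where "n = r - m * (1 + \<bar>L + min 0 B\<bar>)"
      have "\<bar>L + min 0 B\<bar> \<le> m * \<bar>L + min 0 B\<bar>"
        using mult_right_mono[of 1 m "\<bar>L + min 0 B\<bar>"] assms(1) by simp
      then have n: "n < L + min 0 B" using r unfolding n_def distrib_left atLeastLessThan_iff by linarith
      have "[n = r] (mod m)"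
        unfolding n_def cong_iff_dvd_diff by simp
      obtain a w where aw: "a \<in> A" "w \<in> W" "n = a + w"
        using A unfolding is_minimal_complement_def is_complement_def
        by (metis UNIV_I set_plus_elim)
      then have "a < L" using n W_bound[of w] by linarith
      then have aC: "a mod m \<in> C" using L aw(1) by blast
      obtain z where z: "z \<in> X \<union> Y1" "[w = z] (mod m)"
        using W_cases[OF aw(2)] by (auto intro: that)
      have "[a + w = a mod m + z] (mod m)"
        by (rule cong_add) (use z in \<open>auto simp: cong_def\<close>)
      then have "[r = a mod m + z] (mod m)"
        using \<open>[n = r] (mod m)\<close> aw(3) by (metis cong_sym cong_trans)
      then show ?thesis
        using r set_plus_intro[OF aC z(1)] by (auto simp: set_mod_def)
    qed
    then show "(C + (X \<union> Y1)) smod m = {0..<m}" by (auto simp: set_mod_def)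
  next
    show "\<forall>c\<in>C. \<exists>y\<in>Y1. \<forall>c'\<in>C. \<forall>x\<in>X. \<not> [c + y = c' + x] (mod m)"
    proof
      fix c assume c: "c \<in> C"
      then obtain a where a: "a \<in> A" "[a = c] (mod m)"
        by (auto simp: C_def low_residues_def)
      obtain n where n: "n - a \<in> W" and only: "\<And>a'. a' \<in> A \<Longrightarrow> n - a' \<in> W \<Longrightarrow> a' = a"
        using needed_in_minimal_complement[OF A a(1)] by metis
      have avoid: "\<not> [n = c' + x] (mod m)" if "c' \<in> C" "x \<in> X" for c' x
      proof
        assume "[n = c' + x] (mod m)"
        then obtain a' where "a' \<in> A" "a' < a" "n - a' \<in> m *o \<nat> + X"
          using low_residues_represent[OF assms(1) _ \<open>x \<in> X\<close>] \<open>c' \<in> C\<close> unfolding C_def by metis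
        with only[of a'] assms(8) show False by auto
      qed
      have cn: "[n = c + (n - a)] (mod m)"
        using cong_add[OF a(2) cong_refl[of "n - a"]] by simp
      have "n - a \<in> Y1"
      proof (rule ccontr)
        assume "n - a \<notin> Y1"
        then obtain x where "x \<in> X" "[n - a = x] (mod m)" using W_cases[OF n] by blast
        then have "[n = c + x] (mod m)"
          using cong_add[OF a(2)] by fastforce
        with avoid c \<open>x \<in> X\<close> show False by blast
      qed
      moreover have "\<forall>c'\<in>C. \<forall>x\<in>X. \<not> [c + (n - a) = c' + x] (mod m)"
        using avoid cn by (meson cong_trans)
      ultimately show "\<exists>y\<in>Y1. \<forall>c'\<in>C. \<forall>x\<in>X. \<not> [c + y = c' + x] (mod m)" by blast
    qed
  qed
qed

end
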